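(* Let $f:[0,\infty)\to[0,\infty)$, $K>0$, $M\ge1$ and $c$ satisfy Assumptions A and B (stated in the context). Suppose there are $\varepsilon\in(0,K)$ and $M_\varepsilon$ with $M>M_\varepsilon>1$ such that $$|f(x)-K|\le M_\varepsilon|x-K|,\qquad x\in(K-\varepsilon,K+\varepsilon).$$ Suppose further that one of the following two conditions holds: (1) $\{\xi_n\}$ satisfies Assumption N (stated in the context) with $\nu=1$, $$\alpha\in\left(1-\frac1{2M_\varepsilon}-\frac1{2M},\,1\right),$$ and $$l\in\left(\max\left\{1-\frac1M-\alpha,\,0\right\},\ \min\left\{\alpha-\left(1-\frac1{M_\varepsilon}\right),\,1-\alpha\right\}\right);$$ (2) $\{\xi_n\}$ satisfies Assumption N with $\nu>1$, and $\alpha\in\left(1-\frac1{M_\varepsilon},1\right)$ is such that $$1-\frac1M-\alpha<\nu\left(\alpha-\left(1-\frac1{M_\varepsilon}\right)\right)$$ and $$l\in\left(\frac1\nu\max\left\{1-\frac1M-\alpha,\,0\right\},\ \min\left\{\alpha-\left(1-\frac1{M_\varepsilon}\right),\,\frac{1-\alpha}{\nu}\right\}\right).$$ Let $\{x_n\}_{n\in\mathbb{N}_0}$ be any solution of $$x_{n+1}=\max\left\{f(x_n)-(\alpha+l\xi_{n+1})(f(x_n)-x_n),\,0\right\},\qquad n\in\mathbb{N}_0,$$ with $x_0>0$. Then $$\lim_{n\to\infty}x_n=K\quad\text{a.s.}$$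
   Context: $\mathbb{N}_0=\{0,1,2,\dots\}$. Assumption A: $f:[0,\infty)\to[0,\infty)$ is a continuous function, $f(x)>0$ for $x>0$, $f(x)>x$ for $x\in(0,K)$, $f(x)<x$ for $x>K$, and $M\ge1$ is a constant such that $|f(x)-K|\le M|x-K|$ for all $x\ge 0$. (Hence $K>0$ is the unique positive fixed point of $f$.) Assumption B: there is a point $c\in[0,K)$ such that $f$ is strictly decreasing on $[c,\infty)$. Probabilistic setting: $(\Omega,\mathcal F,\{\mathcal F_n\},\mathbb P)$ is a complete filtered probability space whose filtration is the one generated by the sequence $\{\xi_n\}$, and $x_0$ is a deterministic initial value. "a.s." is with respect to $\mathbb P$. Assumption N (with parameter $\nu\ge1$): $\{\xi_n\}$ is a sequence of independent identically distributed continuous random variables with common density function $\phi$ whose support is the interval $[-1,\nu]$; $\xi_n(\omega)\in[-1,\nu]$ for all $n$ and all $\omega\in\Omega$, and every nondegenerate subinterval of $[-1,\nu]$ has positive probability under the law of $\xi_n$. *)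

theory Defs
  imports "HOL-Probability.Probability"
begin

text \<open>
  Functions on \<open>[0, \<infinity>)\<close> are represented by total functions on the reals, of which only the
  values on \<open>{0..}\<close> are constrained.
\<close>

definition assumption_A :: "(real \<Rightarrow> real) \<Rightarrow> real \<Rightarrow> real \<Rightarrow> bool" where
  "assumption_A f K M \<longleftrightarrow>
     f \<in> {0..} \<rightarrow> {0..} \<and>
     continuous_on {0..} f \<and>
     (\<forall>x>0. f x > 0) \<and>
     (\<forall>x\<in>{0<..<K}. f x > x) \<and>
     (\<forall>x\<ge>0. x > K \<longrightarrow> f x < x) \<and>
     M \<ge> 1 \<and>
     (\<forall>x\<ge>0. \<bar>f x - K\<bar> \<le> M * \<bar>x - K\<bar>)"

definition assumption_B :: "(real \<Rightarrow> real) \<Rightarrow> real \<Rightarrow> real \<Rightarrow> bool" where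
  "assumption_B f K c \<longleftrightarrow> c \<in> {0..<K} \<and> strict_antimono_on {c..} f"

text \<open>
  The noise sequence is \<open>\<xi> 1, \<xi> 2, \<dots>\<close>; the value \<open>\<xi> 0\<close> is irrelevant. In particular the
  \<open>\<sigma>\<close>-algebra at time \<open>0\<close> is trivial.
\<close>

definition generated_filtration :: "'a measure \<Rightarrow> (nat \<Rightarrow> 'a \<Rightarrow> real) \<Rightarrow> nat \<Rightarrow> 'a measure" where
  "generated_filtration P \<xi> n =
     sigma (space P) {\<xi> i -` B \<inter> space P | i B. i \<in> {1..n} \<and> B \<in> sets borel}"

lemma filtration_generated_filtration: "filtration (space P) (generated_filtration P \<xi>)"
proof
  show "space (generated_filtration P \<xi> n) = space P" for n
    unfolding generated_filtration_def by (rule space_measure_of) auto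
  fix m n :: nat
  assume "m \<le> n"
  then have sub: "{\<xi> i -` B \<inter> space P | i B. i \<in> {1..m} \<and> B \<in> sets borel}
      \<subseteq> {\<xi> i -` B \<inter> space P | i B. i \<in> {1..n} \<and> B \<in> sets borel}"
    by fastforce
  show "sets (generated_filtration P \<xi> m) \<subseteq> sets (generated_filtration P \<xi> n)"
    unfolding generated_filtration_def using sigma_sets_mono'[OF sub]
    by (subst (1 2) sets_measure_of) auto
qed

text \<open>
  ``Continuous random variable'' means having a Lebesgue density, and the support of the density
  \<open>\<phi>\<close> is the closure of the set where \<open>\<phi>\<close> does not vanish.
\<close>

definition assumption_N ::
  "'a measure \<Rightarrow> (nat \<Rightarrow> 'a \<Rightarrow> real) \<Rightarrow> (real \<Rightarrow> real) \<Rightarrow> real \<Rightarrow> bool" where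
  "assumption_N P \<xi> \<phi> \<nu> \<longleftrightarrow>
     \<nu> \<ge> 1 \<and>
     prob_space.indep_vars P (\<lambda>_. borel) \<xi> {1..} \<and>
     (\<forall>t. \<phi> t \<ge> 0) \<and>
     (\<forall>n\<ge>1. distributed P lborel (\<xi> n) (\<lambda>t. ennreal (\<phi> t))) \<and>
     closure {t. \<phi> t \<noteq> 0} = {-1..\<nu>} \<and>
     (\<forall>n\<ge>1. \<forall>\<omega>\<in>space P. \<xi> n \<omega> \<in> {-1..\<nu>}) \<and>
     (\<forall>n\<ge>1. \<forall>J. is_interval J \<longrightarrow> J \<subseteq> {-1..\<nu>} \<longrightarrow> (\<exists>a\<in>J. \<exists>b\<in>J. a < b) \<longrightarrow>
        measure (distr P borel (\<xi> n)) J > 0)"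

end

theory Submission
  imports Defs
begin

text \<open>
  Write \<open>a\<^sub>n = \<alpha> + l * \<xi>\<^sub>n\<^sub>+\<^sub>1\<close> for the random control, so that
  \<open>x\<^sub>n\<^sub>+\<^sub>1 = (1 - a\<^sub>n) f(x\<^sub>n) + a\<^sub>n x\<^sub>n\<close>, truncated at \<open>0\<close>. In both cases of the theorem, with
  \<open>[-1, \<mu>]\<close> the range of the noise, the bounds on \<open>l\<close> give \<open>l > 0\<close> and three inequalities:
  \<open>\<alpha> - l > 1 - 1/M\<^sub>\<epsilon>\<close>, \<open>\<alpha> + l\<mu> > 1 - 1/M\<close> and \<open>\<alpha> + l\<mu> < 1\<close>.
  The last one keeps \<open>a\<^sub>n\<close> bounded away from \<open>1\<close>, so \<open>x\<^sub>n\<close> always moves towards \<open>f(x\<^sub>n)\<close>, that is,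
  in the direction of \<open>K\<close>, by a fixed fraction of \<open>\<bar>f(x\<^sub>n) - x\<^sub>n\<bar>\<close>. The danger is overshooting.

  The key observation (\<open>relaxed_step_bound\<close>) is that a control \<open>a \<ge> 1 - 1/L\<close> tames any point \<open>y\<close> with
  \<open>\<bar>f(y) - K\<bar> \<le> L * \<bar>y - K\<bar>\<close>: if the step passes \<open>K\<close> at all, then the new distance to \<open>K\<close> is at most
  the old one divided by \<open>L\<close>. Hence every step is safe while \<open>x\<^sub>n\<close> is \<open>\<epsilon>\<close>-close to \<open>K\<close>, because the
  smallest control exceeds \<open>1 - 1/M\<^sub>\<epsilon>\<close>; away from \<open>K\<close> a step is safe whenever the noise is so near
  to its maximum \<open>\<mu>\<close> that the control exceeds \<open>1 - 1/M\<close>, which has positive probability.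

  To make the gain of a safe step uniform, one uses compactness. A function that decreases beyond
  \<open>c\<close> is bounded, and therefore the solution stays in some interval \<open>[\<delta>, R]\<close> with \<open>\<delta> > 0\<close>,
  whatever the noise (\<open>invariant_interval\<close>). In that interval the only fixed point of \<open>f\<close> is \<open>K\<close>,
  so outside any neighbourhood of \<open>K\<close> a safe step reduces the distance to \<open>K\<close> by at least a
  constant (\<open>uniform_approach\<close>), and boundedly many consecutive safe steps lead into that
  neighbourhood (\<open>reaches_ball\<close>). Consequently there is an \<open>N\<close> such that \<open>N\<close> consecutive large values
  of the noise, at any time, force the solution into the \<open>\<epsilon>\<close>-neighbourhood, and from then on it
  converges to \<open>K\<close> deterministically (\<open>long_run_convergence\<close>). By independence
  such a run of large values almost surely occurs (\<open>indep_events_AE_run\<close>).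
\<close>

section \<open>One step of the controlled recursion\<close>

text \<open>
  The two terms of the maximum correspond to landing on the same side of \<open>K\<close> as \<open>y\<close>, where the
  distance shrinks by the length \<open>(1 - a) * \<bar>z - y\<bar> \<ge> (1 - A) * \<bar>z - y\<bar>\<close> of the step, and to landing on
  the other side.
  In the second case the overshoot is at most
  \<open>((1 - a) L - a) * \<bar>y - K\<bar>\<close>, and \<open>a \<ge> 1 - 1/L\<close> gives \<open>(1 - a) L - a \<le> 1 - a \<le> 1/L\<close>.
\<close>

lemma relaxed_step_bound:
  fixes y z K L a A :: real
  assumes L: "L > 1" and a: "a \<in> {1 - 1 / L..A}" and "A < 1"
    and below: "y < K \<Longrightarrow> y < z" and above: "K < y \<Longrightarrow> z < y"
    and lip: "\<bar>z - K\<bar> \<le> L * \<bar>y - K\<bar>"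
  shows "\<bar>z - a * (z - y) - K\<bar> \<le> max (\<bar>y - K\<bar> - (1 - A) * \<bar>z - y\<bar>) (\<bar>y - K\<bar> / L)"
proof -
  have a1: "1 - a \<ge> 0" "1 - a \<le> 1 / L" and aA: "1 - A \<le> 1 - a"
    using a \<open>A < 1\<close> by auto
  have aL: "(1 - a) * L \<le> 1"
    using a1(2) L by (simp add: field_simps)
  have overshoot: "(1 - a) * w - a * d \<le> d / L" if "w \<le> L * d" "d \<ge> 0" for w d
  proof -
    have "(1 - a) * w \<le> (1 - a) * L * d"
      using mult_left_mono[OF that(1) a1(1)] by (simp add: mult.assoc)
    also have "\<dots> \<le> 1 * d"
      using aL that(2) by (intro mult_right_mono) auto
    finally have "(1 - a) * w - a * d \<le> (1 - a) * d"
      by (simp add: algebra_simps)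
    also have "\<dots> \<le> 1 / L * d"
      using a1(2) that(2) by (intro mult_right_mono) auto
    finally show ?thesis by simp
  qed
  consider "y < K" | "y = K" | "K < y" by linarith
  then show ?thesis
  proof cases
    case 1
    have "(1 - A) * (z - y) \<le> (1 - a) * (z - y)"
      using aA below[OF 1] by (intro mult_right_mono) auto
    moreover have "(1 - a) * (z - K) - a * (K - y) \<le> (K - y) / L"
      using lip 1 by (intro overshoot) auto
    ultimately show ?thesis
      using 1 below[OF 1] by (simp add: abs_if algebra_simps le_max_iff_disj)
  next
    case 2
    then show ?thesis using lip by simp
  next
    case 3
    have "(1 - A) * (y - z) \<le> (1 - a) * (y - z)"
      using aA above[OF 3] by (intro mult_right_mono) auto
    moreover have "(1 - a) * (K - z) - a * (y - K) \<le> (y - K) / L"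
      using lip 3 by (intro overshoot) auto
    ultimately show ?thesis
      using 3 above[OF 3] by (simp add: abs_if algebra_simps le_max_iff_disj)
  qed
qed

lemma assumption_A_step_bound:
  assumes "assumption_A f K M" and "y > 0" and "L > 1" and "a \<in> {1 - 1 / L..A}" and "A < 1"
    and "\<bar>f y - K\<bar> \<le> L * \<bar>y - K\<bar>"
  shows "\<bar>f y - a * (f y - y) - K\<bar>
    \<le> max (\<bar>y - K\<bar> - (1 - A) * \<bar>f y - y\<bar>) (\<bar>y - K\<bar> / L)"
  using assms by (intro relaxed_step_bound) (auto simp: assumption_A_def)

lemma assumption_A_step_le:
  assumes "assumption_A f K M" and "y > 0" and "L > 1" and "a \<in> {1 - 1 / L..A}" and "A < 1"
    and "\<bar>f y - K\<bar> \<le> L * \<bar>y - K\<bar>"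
  shows "\<bar>f y - a * (f y - y) - K\<bar> \<le> \<bar>y - K\<bar>"
proof -
  have "(1 - A) * \<bar>f y - y\<bar> \<ge> 0"
    using \<open>A < 1\<close> by simp
  moreover have "\<bar>y - K\<bar> / L \<le> \<bar>y - K\<bar>"
    using \<open>L > 1\<close> by (simp add: divide_le_eq mult_le_cancel_left1)
  ultimately show ?thesis
    using assumption_A_step_bound[OF assms] by linarith
qed

section \<open>Uniform progress towards the fixed point\<close>

text \<open>
  On the compact set of those \<open>y \<in> [\<delta>, R]\<close> that are at distance at least \<open>e\<close> from \<open>K\<close> the continuous
  function \<open>\<bar>f y - y\<bar>\<close> has a positive minimum, since \<open>K\<close> is the only positive fixed point. This makes
  the gain in the first term of the one-step bound uniform; in the second term the
  gain is \<open>(1 - 1/L) * \<bar>y - K\<bar>\<close>.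
\<close>

lemma uniform_approach:
  assumes A: "assumption_A f K M" and "L > 1" and "A < 1" and "\<delta> > 0" and "e > 0"
  obtains \<eta> where "\<eta> > 0"
    and "\<And>y a. \<lbrakk>y \<in> {\<delta>..R}; a \<in> {1 - 1 / L..A}; \<bar>f y - K\<bar> \<le> L * \<bar>y - K\<bar>; e \<le> \<bar>y - K\<bar>\<rbrakk>
      \<Longrightarrow> \<bar>f y - a * (f y - y) - K\<bar> \<le> \<bar>y - K\<bar> - \<eta>"
proof -
  define S where "S = {\<delta>..R} \<inter> {y. e \<le> \<bar>y - K\<bar>}"
  have "compact S"
    unfolding S_def
    by (intro compact_Int_closed compact_Icc closed_Collect_le continuous_intros)
  have "continuous_on S f"
    using A \<open>\<delta> > 0\<close> unfolding assumption_A_def S_def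
    by (auto intro: continuous_on_subset)
  then have cont: "continuous_on S (\<lambda>y. \<bar>f y - y\<bar>)"
    by (intro continuous_intros)
  have moved: "\<bar>f y - y\<bar> > 0" if "y \<in> S" for y
  proof -
    have "y > 0" "y < K \<or> y > K"
      using that \<open>\<delta> > 0\<close> \<open>e > 0\<close> by (auto simp: S_def)
    moreover have "y \<in> {0<..<K} \<longrightarrow> y < f y" "y \<ge> 0 \<and> y > K \<longrightarrow> f y < y"
      using A unfolding assumption_A_def by blast+
    ultimately show ?thesis by auto
  qed
  obtain \<mu> where \<mu>: "\<mu> > 0" "\<And>y. y \<in> S \<Longrightarrow> \<mu> \<le> \<bar>f y - y\<bar>"
  proof (cases "S = {}")
    case True
    then show ?thesis using that[of 1] by simp
  next
    case False
    then obtain y0 where "y0 \<in> S" "\<And>y. y \<in> S \<Longrightarrow> \<bar>f y0 - y0\<bar> \<le> \<bar>f y - y\<bar>"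
      using continuous_attains_inf[OF \<open>compact S\<close> _ cont] by blast
    then show ?thesis using that moved by blast
  qed
  define \<eta> where "\<eta> = min ((1 - A) * \<mu>) ((1 - 1 / L) * e)"
  show ?thesis
  proof
    show "\<eta> > 0"
      using \<open>A < 1\<close> \<open>L > 1\<close> \<open>e > 0\<close> \<mu>(1) by (simp add: \<eta>_def)
  next
    fix y a
    assume y: "y \<in> {\<delta>..R}" and a: "a \<in> {1 - 1 / L..A}"
      and lip: "\<bar>f y - K\<bar> \<le> L * \<bar>y - K\<bar>" and far: "e \<le> \<bar>y - K\<bar>"
    have "(1 - A) * \<mu> \<le> (1 - A) * \<bar>f y - y\<bar>"
      using \<mu>(2) y far \<open>A < 1\<close> by (intro mult_left_mono) (auto simp: S_def)
    moreover have "(1 - 1 / L) * e \<le> (1 - 1 / L) * \<bar>y - K\<bar>"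
      using far \<open>L > 1\<close> by (intro mult_left_mono) auto
    then have "\<bar>y - K\<bar> / L \<le> \<bar>y - K\<bar> - (1 - 1 / L) * e"
      by (simp add: left_diff_distrib)
    moreover have "y > 0" using y \<open>\<delta> > 0\<close> by auto
    ultimately show "\<bar>f y - a * (f y - y) - K\<bar> \<le> \<bar>y - K\<bar> - \<eta>"
      using assumption_A_step_bound[OF A _ \<open>L > 1\<close> a \<open>A < 1\<close> lip] unfolding \<eta>_def
      by linarith
  qed
qed

text \<open>
  Each step outside the ball takes at least a fixed \<open>\<eta>\<close> off a distance that is initially at most
  \<open>\<bar>R\<bar> + \<bar>K\<bar>\<close>. It matters that \<open>N\<close> is chosen before the sequences \<open>x\<close> and \<open>a\<close>: then a single run length
  serves all outcomes of the noise and all starting times. The lemma is applied both globally, with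
  the constant \<open>M\<close> and a ball of fixed radius, and locally, with the smaller constant valid near
  \<open>K\<close> and arbitrarily small balls.
\<close>

lemma reaches_ball:
  assumes A: "assumption_A f K M" and "L > 1" and "A < 1" and "\<delta> > 0" and "e > 0"
  obtains N :: nat where
    "\<And>(x :: nat \<Rightarrow> real) a. (\<And>i. i < N \<Longrightarrow> a i \<in> {1 - 1 / L..A} \<and>
        x i \<in> {\<delta>..R} \<and> \<bar>f (x i) - K\<bar> \<le> L * \<bar>x i - K\<bar> \<and>
        x (Suc i) = f (x i) - a i * (f (x i) - x i))
      \<Longrightarrow> x 0 \<in> {\<delta>..R} \<Longrightarrow> \<exists>i\<le>N. \<bar>x i - K\<bar> < e"
proof -
  obtain \<eta> where "\<eta> > 0" and \<eta>:
    "\<And>y a. \<lbrakk>y \<in> {\<delta>..R}; a \<in> {1 - 1 / L..A}; \<bar>f y - K\<bar> \<le> L * \<bar>y - K\<bar>; e \<le> \<bar>y - K\<bar>\<rbrakk>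
      \<Longrightarrow> \<bar>f y - a * (f y - y) - K\<bar> \<le> \<bar>y - K\<bar> - \<eta>"
    using uniform_approach[OF assms] by metis
  obtain N :: nat where N: "\<bar>R\<bar> + \<bar>K\<bar> < real N * \<eta>"
    using reals_Archimedean3[OF \<open>\<eta> > 0\<close>] by blast
  show ?thesis
  proof (rule that[of N], rule ccontr)
    fix x :: "nat \<Rightarrow> real" and a
    assume step: "\<And>i. i < N \<Longrightarrow> a i \<in> {1 - 1 / L..A} \<and>
        x i \<in> {\<delta>..R} \<and> \<bar>f (x i) - K\<bar> \<le> L * \<bar>x i - K\<bar> \<and>
        x (Suc i) = f (x i) - a i * (f (x i) - x i)"
      and x0: "x 0 \<in> {\<delta>..R}"
      and "\<not> (\<exists>i\<le>N. \<bar>x i - K\<bar> < e)"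
    then have far: "e \<le> \<bar>x i - K\<bar>" if "i \<le> N" for i
      using that by force
    have "\<bar>x i - K\<bar> \<le> \<bar>x 0 - K\<bar> - real i * \<eta>" if "i \<le> N" for i
      using that
    proof (induction i)
      case (Suc i)
      then have "\<bar>x (Suc i) - K\<bar> \<le> \<bar>x i - K\<bar> - \<eta>"
        using step[of i] far[of i] by (auto intro!: \<eta>)
      then show ?case
        using Suc by (simp add: algebra_simps)
    qed simp
    from this[of N] have "\<bar>x N - K\<bar> < 0"
      using N x0 \<open>\<delta> > 0\<close> by auto
    then show False by simp
  qed
qed

text \<open>
  Where the better constant \<open>L\<close> is valid, no step increases the distance to \<open>K\<close>. So the solution never
  leaves the \<open>r\<close>-ball again, nor any smaller ball once it has reached that, and
  it reaches every smaller ball.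
\<close>

lemma local_convergence:
  fixes x a :: "nat \<Rightarrow> real"
  assumes A: "assumption_A f K M" and "L > 1" and "A < 1" and "\<delta> > 0"
    and loc: "\<And>y. \<bar>y - K\<bar> < r \<Longrightarrow> \<bar>f y - K\<bar> \<le> L * \<bar>y - K\<bar>"
    and a: "\<And>n. a n \<in> {1 - 1 / L..A}" and x: "\<And>n. x n \<in> {\<delta>..R}"
    and step: "\<And>n. x (Suc n) = f (x n) - a n * (f (x n) - x n)"
    and start: "\<bar>x m - K\<bar> < r"
  shows "x \<longlonglongrightarrow> K"
proof -
  have mono: "\<bar>x (k + i) - K\<bar> \<le> \<bar>x k - K\<bar>" if "\<bar>x k - K\<bar> < r" for k i
  proof (induction i)
    case (Suc i)
    have "x (k + i) > 0" using x[of "k + i"] \<open>\<delta> > 0\<close> by simp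
    then have "\<bar>x (Suc (k + i)) - K\<bar> \<le> \<bar>x (k + i) - K\<bar>"
      unfolding step[of "k + i"] using Suc that
      by (intro assumption_A_step_le[OF A _ \<open>L > 1\<close> a \<open>A < 1\<close>] loc) auto
    with Suc show ?case by simp
  qed simp
  have "\<exists>k. \<forall>n\<ge>k. \<bar>x n - K\<bar> < e" if "e > 0" for e
  proof -
    obtain N where N: "\<And>(x :: nat \<Rightarrow> real) a. (\<And>i. i < N \<Longrightarrow> a i \<in> {1 - 1 / L..A} \<and>
        x i \<in> {\<delta>..R} \<and> \<bar>f (x i) - K\<bar> \<le> L * \<bar>x i - K\<bar> \<and>
        x (Suc i) = f (x i) - a i * (f (x i) - x i))
      \<Longrightarrow> x 0 \<in> {\<delta>..R} \<Longrightarrow> \<exists>i\<le>N. \<bar>x i - K\<bar> < e"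
      using reaches_ball[OF A \<open>L > 1\<close> \<open>A < 1\<close> \<open>\<delta> > 0\<close> \<open>e > 0\<close>] by metis
    have "\<exists>i\<le>N. \<bar>x (m + i) - K\<bar> < e"
    proof (rule N[where x = "\<lambda>i. x (m + i)" and a = "\<lambda>i. a (m + i)"])
      fix i
      have "\<bar>f (x (m + i)) - K\<bar> \<le> L * \<bar>x (m + i) - K\<bar>"
        using mono[OF start, of i] start by (intro loc) simp
      then show "a (m + i) \<in> {1 - 1 / L..A} \<and> x (m + i) \<in> {\<delta>..R} \<and>
          \<bar>f (x (m + i)) - K\<bar> \<le> L * \<bar>x (m + i) - K\<bar> \<and>
          x (m + Suc i) = f (x (m + i)) - a (m + i) * (f (x (m + i)) - x (m + i))"
        using a x step by simp
    qed (use x in simp)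
    then obtain i where i: "\<bar>x (m + i) - K\<bar> < e" by blast
    have "\<bar>x n - K\<bar> < e" if "n \<ge> m + i" for n
    proof -
      have "\<bar>x (m + i) - K\<bar> < r"
        using mono[OF start, of i] start by simp
      from mono[OF this, of "n - (m + i)"] show ?thesis
        using i that by simp
    qed
    then show ?thesis by blast
  qed
  then show ?thesis
    by (simp add: lim_sequentially dist_real_def)
qed

section \<open>Confinement to a compact interval\<close>

text \<open>
  The new point lies between \<open>y\<close> and \<open>f y\<close>, so it suffices that \<open>f\<close> maps the interval into itself.
  For \<open>R\<close> one needs an upper bound of \<open>f\<close>, which exists because \<open>f\<close> is continuous on \<open>[0, c]\<close> and
  decreasing afterwards. For \<open>\<delta>\<close> note that \<open>f y > y\<close> below \<open>K\<close>, so only the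
  positive minimum of \<open>f\<close> over \<open>[K, R]\<close> has to be respected.
\<close>

lemma invariant_interval:
  assumes A: "assumption_A f K M" and B: "assumption_B f K c" and "K > 0" and "x\<^sub>0 > 0"
  obtains \<delta> R where "0 < \<delta>" and "x\<^sub>0 \<in> {\<delta>..R}"
    and "\<And>y a. \<lbrakk>y \<in> {\<delta>..R}; a \<in> {0..1}\<rbrakk> \<Longrightarrow> f y - a * (f y - y) \<in> {\<delta>..R}"
proof -
  have cont: "continuous_on {0..} f" and pos: "\<And>y. y > 0 \<Longrightarrow> f y > 0"
    and below: "\<And>y. \<lbrakk>0 < y; y < K\<rbrakk> \<Longrightarrow> y < f y"
    using A by (auto simp: assumption_A_def)
  have c: "0 \<le> c" "c < K" and dec: "strict_antimono_on {c..} f"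
    using B by (auto simp: assumption_B_def)
  obtain y1 where y1: "\<And>y. y \<in> {0..c} \<Longrightarrow> f y \<le> f y1"
  proof -
    have "continuous_on {0..c} f" "{0..c} \<noteq> {}"
      using c by (auto intro: continuous_on_subset[OF cont])
    with continuous_attains_sup[OF compact_Icc] show thesis
      using that by blast
  qed
  have bounded: "f y \<le> f y1" if "y \<ge> 0" for y
  proof (cases "y \<le> c")
    case False
    then have "f y < f c"
      using dec by (auto simp: monotone_on_def)
    with y1[of c] c show ?thesis by simp
  qed (use that y1 in simp)
  define R where "R = Max {x\<^sub>0, f y1, K}"
  have R: "x\<^sub>0 \<le> R" "f y1 \<le> R" "K \<le> R"
    by (simp_all add: R_def)
  obtain y2 where y2: "y2 \<in> {K..R}" "\<And>y. y \<in> {K..R} \<Longrightarrow> f y2 \<le> f y"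
  proof -
    have "continuous_on {K..R} f" "{K..R} \<noteq> {}"
      using R(3) \<open>K > 0\<close> by (auto intro: continuous_on_subset[OF cont])
    with continuous_attains_inf[OF compact_Icc] show thesis
      using that by blast
  qed
  define \<delta> where "\<delta> = Min {x\<^sub>0, f y2, K}"
  have \<delta>: "\<delta> \<le> x\<^sub>0" "\<delta> \<le> f y2" "\<delta> \<le> K" "\<delta> > 0"
    using \<open>x\<^sub>0 > 0\<close> \<open>K > 0\<close> y2(1) pos by (auto simp: \<delta>_def)
  show ?thesis
  proof
    show "0 < \<delta>" "x\<^sub>0 \<in> {\<delta>..R}" using \<delta> R by auto
  next
    fix y a :: real
    assume y: "y \<in> {\<delta>..R}" and a: "a \<in> {0..1}"
    have "f y \<in> {\<delta>..R}"
    proof (cases "y < K")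
      case True
      then show ?thesis using below[of y] bounded[of y] y \<delta> R by auto
    next
      case False
      then show ?thesis using y2(2)[of y] bounded[of y] y \<delta> R by auto
    qed
    then have "(1 - a) *\<^sub>R f y + a *\<^sub>R y \<in> {\<delta>..R}"
      using y a by (intro convexD[OF convex_real_interval(5)]) auto
    then show "f y - a * (f y - y) \<in> {\<delta>..R}"
      by (simp add: algebra_simps)
  qed
qed

text \<open>
  The truncation at \<open>0\<close> is never active, because the invariant interval consists of positive
  numbers. The length \<open>N\<close> of the run depends on the initial value but neither on the controls
  nor on the time at which the run starts; this is what allows the random argument to look for a run
  anywhere in the sequence.
\<close>

lemma long_run_convergence:
  assumes A: "assumption_A f K M" and B: "assumption_B f K c" and "K > 0" and "x\<^sub>0 > 0"
    and "L > 1" and "M > 1" and "A < 1" and "r > 0"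
    and loc: "\<And>y. \<bar>y - K\<bar> < r \<Longrightarrow> \<bar>f y - K\<bar> \<le> L * \<bar>y - K\<bar>"
  obtains N :: nat where "\<And>x a :: nat \<Rightarrow> real. \<lbrakk>x 0 = x\<^sub>0; \<And>n. a n \<in> {1 - 1 / L..A};
      \<And>n. x (Suc n) = max (f (x n) - a n * (f (x n) - x n)) 0;
      \<exists>m. \<forall>i<N. 1 - 1 / M \<le> a (m + i)\<rbrakk> \<Longrightarrow> x \<longlonglongrightarrow> K"
proof -
  obtain \<delta> R where "0 < \<delta>" and x0: "x\<^sub>0 \<in> {\<delta>..R}"
    and inv: "\<And>y a. \<lbrakk>y \<in> {\<delta>..R}; a \<in> {0..1}\<rbrakk> \<Longrightarrow> f y - a * (f y - y) \<in> {\<delta>..R}"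
    using invariant_interval[OF A B \<open>K > 0\<close> \<open>x\<^sub>0 > 0\<close>] by metis
  obtain N where N: "\<And>(x :: nat \<Rightarrow> real) a. (\<And>i. i < N \<Longrightarrow> a i \<in> {1 - 1 / M..A} \<and>
        x i \<in> {\<delta>..R} \<and> \<bar>f (x i) - K\<bar> \<le> M * \<bar>x i - K\<bar> \<and>
        x (Suc i) = f (x i) - a i * (f (x i) - x i))
      \<Longrightarrow> x 0 \<in> {\<delta>..R} \<Longrightarrow> \<exists>i\<le>N. \<bar>x i - K\<bar> < r"
    using reaches_ball[OF A \<open>M > 1\<close> \<open>A < 1\<close> \<open>\<delta> > 0\<close> \<open>r > 0\<close>] by metis
  show ?thesis
  proof (rule that[of N])
    fix x a :: "nat \<Rightarrow> real"
    assume init: "x 0 = x\<^sub>0" and a: "\<And>n. a n \<in> {1 - 1 / L..A}"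
      and rec: "\<And>n. x (Suc n) = max (f (x n) - a n * (f (x n) - x n)) 0"
      and run: "\<exists>m. \<forall>i<N. 1 - 1 / M \<le> a (m + i)"
    have "1 - 1 / L \<ge> 0" using \<open>L > 1\<close> by simp
    then have a01: "a n \<in> {0..1}" for n
      using a[of n] \<open>A < 1\<close> by auto
    have x: "x n \<in> {\<delta>..R}" for n
    proof (induction n)
      case (Suc n)
      then show ?case
        using inv[OF Suc a01[of n]] \<open>\<delta> > 0\<close> by (simp add: rec max_def)
    qed (use init x0 in simp)
    have step: "x (Suc n) = f (x n) - a n * (f (x n) - x n)" for n
      using inv[OF x a01, of n n] \<open>\<delta> > 0\<close> by (simp add: rec max_def)
    obtain m where m: "\<And>i. i < N \<Longrightarrow> 1 - 1 / M \<le> a (m + i)"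
      using run by blast
    have "\<exists>i\<le>N. \<bar>x (m + i) - K\<bar> < r"
    proof (rule N[where x = "\<lambda>i. x (m + i)" and a = "\<lambda>i. a (m + i)"])
      fix i assume "i < N"
      have "\<bar>f (x (m + i)) - K\<bar> \<le> M * \<bar>x (m + i) - K\<bar>"
        using A x[of "m + i"] \<open>\<delta> > 0\<close> by (simp add: assumption_A_def)
      then show "a (m + i) \<in> {1 - 1 / M..A} \<and> x (m + i) \<in> {\<delta>..R} \<and>
          \<bar>f (x (m + i)) - K\<bar> \<le> M * \<bar>x (m + i) - K\<bar> \<and>
          x (m + Suc i) = f (x (m + i)) - a (m + i) * (f (x (m + i)) - x (m + i))"
        using a[of "m + i"] m[OF \<open>i < N\<close>] x[of "m + i"] step by simp
    qed (use x in simp)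
    then obtain i where "\<bar>x (m + i) - K\<bar> < r" by blast
    then show "x \<longlonglongrightarrow> K"
      by (rule local_convergence[OF A \<open>L > 1\<close> \<open>A < 1\<close> \<open>\<delta> > 0\<close>, rotated -1]) (fact loc a x step)+
  qed
qed

section \<open>Runs of large noise values\<close>

text \<open>
  Overlapping windows are dependent, so the index set is cut into disjoint blocks of length \<open>N\<close>.
  The events that a whole block succeeds are independent with probabilities at least \<open>p ^ N\<close>. Their
  limit superior then also has probability at least \<open>p ^ N > 0\<close>, hence probability \<open>1\<close> by the
  Borel zero-one law.
\<close>

lemma (in prob_space) indep_events_AE_run:
  fixes A :: "nat \<Rightarrow> 'a set"
  assumes indep: "indep_events A UNIV" and "p > 0" and p: "\<And>n. p \<le> prob (A n)"
  shows "AE \<omega> in M. \<exists>m. \<forall>i<N. \<omega> \<in> A (m + i)"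
proof (cases "N = 0")
  case False
  define block where "block k = {k * N..<Suc k * N}" for k
  define E where "E k = (\<Inter>j\<in>block k. A j)" for k
  have block: "finite (block k)" "block k \<noteq> {}" "card (block k) = N" for k
    using False by (auto simp: block_def)
  have disj: "block k \<inter> block k' = {}" if "k \<noteq> k'" for k k'
  proof -
    have "Suc k * N \<le> k' * N \<or> Suc k' * N \<le> k * N"
      using that mult_le_mono1[of "Suc k" k' N] mult_le_mono1[of "Suc k'" k N] by linarith
    then show ?thesis by (auto simp: block_def)
  qed
  have events: "A n \<in> events" for n
    using indep by (auto simp: indep_events_def)
  have prob_Inter: "prob (\<Inter>j\<in>J. A j) = (\<Prod>j\<in>J. prob (A j))" if "finite J" "J \<noteq> {}" for J
    using indep that by (auto simp: indep_events_def)
  have E_events: "E k \<in> events" for k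
    unfolding E_def using block events by (intro sets.finite_INT) auto
  have "indep_events E UNIV"
  proof (rule indep_eventsI)
    fix J :: "nat set"
    assume J: "finite J" "J \<noteq> {}"
    have "(\<Inter>k\<in>J. E k) = (\<Inter>j\<in>(\<Union>k\<in>J. block k). A j)"
      by (auto simp: E_def)
    then have "prob (\<Inter>k\<in>J. E k) = prob (\<Inter>j\<in>(\<Union>k\<in>J. block k). A j)"
      by simp
    also have "\<dots> = (\<Prod>j\<in>(\<Union>k\<in>J. block k). prob (A j))"
      using J block by (intro prob_Inter) auto
    also have "\<dots> = (\<Prod>k\<in>J. \<Prod>j\<in>block k. prob (A j))"
      using J block disj by (intro prod.UNION_disjoint) auto
    also have "\<dots> = (\<Prod>k\<in>J. prob (E k))"
      using block by (simp add: E_def prob_Inter)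
    finally show "prob (\<Inter>k\<in>J. E k) = (\<Prod>k\<in>J. prob (E k))" .
  qed (rule E_events)
  then have "prob (\<Inter>n. \<Union>k\<in>{n..}. E k) = 0 \<or> prob (\<Inter>n. \<Union>k\<in>{n..}. E k) = 1"
    by (rule borel_0_1_law)
  moreover have "p ^ N \<le> prob (\<Inter>n. \<Union>k\<in>{n..}. E k)"
  proof (rule LIMSEQ_le_const)
    show "(\<lambda>n. prob (\<Union>k\<in>{n..}. E k)) \<longlonglongrightarrow> prob (\<Inter>n. \<Union>k\<in>{n..}. E k)"
    proof (intro finite_Lim_measure_decseq)
      show "decseq (\<lambda>n. \<Union>k\<in>{n..}. E k)"
        by (intro decseq_SucI UN_mono) auto
    qed (use E_events in auto)
    have "p ^ N \<le> prob (\<Union>k\<in>{n..}. E k)" for n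
    proof -
      have "p ^ N = (\<Prod>j\<in>block n. p)"
        by (simp add: block)
      also have "\<dots> \<le> (\<Prod>j\<in>block n. prob (A j))"
        using p \<open>p > 0\<close> by (intro prod_mono) auto
      also have "\<dots> = prob (E n)"
        using block by (simp add: E_def prob_Inter)
      also have "\<dots> \<le> prob (\<Union>k\<in>{n..}. E k)"
        using E_events by (intro finite_measure_mono) auto
      finally show ?thesis .
    qed
    then show "\<exists>n0. \<forall>n\<ge>n0. p ^ N \<le> prob (\<Union>k\<in>{n..}. E k)"
      by blast
  qed
  moreover have "p ^ N > 0"
    using \<open>p > 0\<close> by simp
  ultimately have "prob (\<Inter>n. \<Union>k\<in>{n..}. E k) = 1"
    by linarith
  then have "AE \<omega> in M. \<omega> \<in> (\<Inter>n. \<Union>k\<in>{n..}. E k)"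
    using E_events by (subst (asm) prob_eq_1) auto
  then show ?thesis
  proof eventually_elim
    case (elim \<omega>)
    then obtain k where "\<omega> \<in> E k" by blast
    then have "\<forall>i<N. \<omega> \<in> A (k * N + i)"
      by (auto simp: E_def block_def)
    then show ?case by blast
  qed
qed simp

text \<open>
  The values of the noise between \<open>s\<close> and the right end \<open>\<nu>\<close> of its range contain a nondegenerate
  interval, which has positive probability, the same at all times because the common density
  determines the law.
\<close>

lemma (in prob_space) noise_AE_run:
  assumes N: "assumption_N M \<xi> \<phi> \<nu>" and "s < \<nu>"
  shows "AE \<omega> in M. \<exists>m. \<forall>i<n. s \<le> \<xi> (Suc (m + i)) \<omega>"
proof -
  have "\<nu> \<ge> 1" and indep: "indep_vars (\<lambda>_. borel) \<xi> {1..}"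
    using N by (auto simp: assumption_N_def)
  \<comment> \<open>\<open>s\<close> may lie below the range of the noise, hence the maximum.\<close>
  define J where "J = {max (-1) s..\<nu>}"
  define A where "A k = {\<omega> \<in> space M. \<xi> (Suc k) \<omega> \<in> J}" for k
  have rv: "random_variable borel (\<xi> (Suc k))" for k
    using indep by (auto simp: indep_vars_def)
  have same_law: "prob (A k) = measure (distr M borel (\<xi> 1)) J" for k
  proof -
    have "distributed M lborel (\<xi> (Suc k)) (\<lambda>t. ennreal (\<phi> t))"
      "distributed M lborel (\<xi> 1) (\<lambda>t. ennreal (\<phi> t))"
      using N by (auto simp: assumption_N_def)
    then have "distr M lborel (\<xi> (Suc k)) = distr M lborel (\<xi> 1)"
      by (simp add: distributed_def)
    then have "distr M borel (\<xi> (Suc k)) = distr M borel (\<xi> 1)"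
      by (metis distr_cong sets_lborel)
    moreover have "prob (A k) = measure (distr M borel (\<xi> (Suc k))) J"
      using rv[of k] by (simp add: measure_distr A_def J_def vimage_def Int_def conj_commute)
    ultimately show ?thesis by simp
  qed
  have "measure (distr M borel (\<xi> 1)) J > 0"
  proof -
    have "is_interval J" "J \<subseteq> {-1..\<nu>}"
      by (auto simp: J_def is_interval_cc)
    moreover have "\<exists>a\<in>J. \<exists>b\<in>J. a < b"
      using \<open>\<nu> \<ge> 1\<close> \<open>s < \<nu>\<close>
      by (intro bexI[of _ "max (-1) s"] bexI[of _ \<nu>]) (auto simp: J_def)
    ultimately show ?thesis
      using N unfolding assumption_N_def by blast
  qed
  moreover have "indep_events A UNIV"
  proof (rule indep_eventsI)
    define B where "B k = {\<omega> \<in> space M. \<xi> k \<omega> \<in> J}" for k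
    \<comment> \<open>The noise starts at time \<open>1\<close>; the events \<open>A\<close> are these shifted to start at \<open>0\<close>.\<close>
    have "indep_events B {1..}"
      unfolding B_def using indep by (rule indep_eventsI_indep_vars) (simp add: J_def)
    then have B: "B ` {1..} \<subseteq> events"
      "\<And>I. \<lbrakk>I \<subseteq> {1..}; I \<noteq> {}; finite I\<rbrakk> \<Longrightarrow> prob (\<Inter>k\<in>I. B k) = (\<Prod>k\<in>I. prob (B k))"
      by (auto simp: indep_events_def)
    have A: "A k = B (Suc k)" for k
      by (simp add: A_def B_def)
    show "A k \<in> events" for k
      using B(1) by (auto simp: A)
    fix I :: "nat set"
    assume "finite I" "I \<noteq> {}"
    then show "prob (\<Inter>k\<in>I. A k) = (\<Prod>k\<in>I. prob (A k))"
      using B(2)[of "Suc ` I"] by (simp add: A prod.reindex image_subset_iff)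
  qed
  ultimately have "AE \<omega> in M. \<exists>m. \<forall>i<n. \<omega> \<in> A (m + i)"
    by (intro indep_events_AE_run) (auto simp: same_law)
  then show ?thesis
    by eventually_elim (force simp: A_def J_def)
qed

section \<open>Almost sure stabilization\<close>

theorem theorem3p10:
  fixes f :: "real \<Rightarrow> real" and K M c \<epsilon> M\<^sub>\<epsilon> \<alpha> l \<nu> x\<^sub>0 :: real
    and P :: "'a measure" and F :: "nat \<Rightarrow> 'a measure"
    and \<xi> :: "nat \<Rightarrow> 'a \<Rightarrow> real" and \<phi> :: "real \<Rightarrow> real"
    and x :: "nat \<Rightarrow> 'a \<Rightarrow> real"
  assumes "prob_space P" and "complete_measure P"
    and "F = generated_filtration P \<xi>"
    and "K > 0" and "assumption_A f K M" and "assumption_B f K c"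
    and "\<epsilon> \<in> {0<..<K}" and "M > M\<^sub>\<epsilon>" and "M\<^sub>\<epsilon> > 1"
    and "\<forall>y\<in>{K - \<epsilon><..<K + \<epsilon>}. \<bar>f y - K\<bar> \<le> M\<^sub>\<epsilon> * \<bar>y - K\<bar>"
    and "(assumption_N P \<xi> \<phi> 1 \<and>
          \<alpha> \<in> {1 - 1 / (2 * M\<^sub>\<epsilon>) - 1 / (2 * M)<..<1} \<and>
          l \<in> {max (1 - 1 / M - \<alpha>) 0<..<min (\<alpha> - (1 - 1 / M\<^sub>\<epsilon>)) (1 - \<alpha>)})
       \<or> (\<nu> > 1 \<and> assumption_N P \<xi> \<phi> \<nu> \<and>
          \<alpha> \<in> {1 - 1 / M\<^sub>\<epsilon><..<1} \<and>
          1 - 1 / M - \<alpha> < \<nu> * (\<alpha> - (1 - 1 / M\<^sub>\<epsilon>)) \<and>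
          l \<in> {1 / \<nu> * max (1 - 1 / M - \<alpha>) 0<..<min (\<alpha> - (1 - 1 / M\<^sub>\<epsilon>)) ((1 - \<alpha>) / \<nu>)})"
    and "x\<^sub>0 > 0"
    and "\<forall>\<omega>\<in>space P. x 0 \<omega> = x\<^sub>0"
    and "\<forall>\<omega>\<in>space P. \<forall>n. x (Suc n) \<omega> =
           max (f (x n \<omega>) - (\<alpha> + l * \<xi> (Suc n) \<omega>) * (f (x n \<omega>) - x n \<omega>)) 0"
  shows "AE \<omega> in P. (\<lambda>n. x n \<omega>) \<longlonglongrightarrow> K"
proof -
  interpret prob_space P by fact
  have "M > 1" using assms by linarith
  \<comment> \<open>From here on both alternatives are treated alike; \<open>\<mu>\<close> is \<open>1\<close> in the first and \<open>\<nu>\<close> in the second.\<close>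
  obtain \<mu> where N: "assumption_N P \<xi> \<phi> \<mu>" and "l > 0"
    and low: "1 - 1 / M\<^sub>\<epsilon> < \<alpha> - l" and high: "\<alpha> + l * \<mu> < 1" and good: "1 - 1 / M < \<alpha> + l * \<mu>"
    using assms(11)
  proof (elim disjE conjE)
    assume "assumption_N P \<xi> \<phi> 1"
      and "l \<in> {max (1 - 1 / M - \<alpha>) 0<..<min (\<alpha> - (1 - 1 / M\<^sub>\<epsilon>)) (1 - \<alpha>)}"
    then show thesis by (intro that[of 1]) auto
  next
    assume "\<nu> > 1" and N: "assumption_N P \<xi> \<phi> \<nu>"
      and l: "l \<in> {1 / \<nu> * max (1 - 1 / M - \<alpha>) 0<..<min (\<alpha> - (1 - 1 / M\<^sub>\<epsilon>)) ((1 - \<alpha>) / \<nu>)}"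
    then have "max (1 - 1 / M - \<alpha>) 0 < l * \<nu>" "l * \<nu> < 1 - \<alpha>"
      by (auto simp: field_simps)
    moreover from this \<open>\<nu> > 1\<close> have "l > 0"
      by (simp add: zero_less_mult_iff)
    ultimately show thesis
      using N l by (intro that[of \<nu>]) auto
  qed
  \<comment> \<open>the noise level above which the control is at least \<open>1 - 1/M\<close>\<close>
  define s where "s = (1 - 1 / M - \<alpha>) / l"
  have "s < \<mu>"
    using good \<open>l > 0\<close> by (simp add: s_def field_simps)
  have loc: "\<bar>f y - K\<bar> \<le> M\<^sub>\<epsilon> * \<bar>y - K\<bar>" if "\<bar>y - K\<bar> < \<epsilon>" for y
    using that assms(10) by (simp add: abs_less_iff)
  obtain n where n: "\<And>u b :: nat \<Rightarrow> real. \<lbrakk>u 0 = x\<^sub>0; \<And>k. b k \<in> {1 - 1 / M\<^sub>\<epsilon>..\<alpha> + l * \<mu>};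
      \<And>k. u (Suc k) = max (f (u k) - b k * (f (u k) - u k)) 0;
      \<exists>m. \<forall>i<n. 1 - 1 / M \<le> b (m + i)\<rbrakk> \<Longrightarrow> u \<longlonglongrightarrow> K"
    using long_run_convergence[OF assms(5,6,4,12,9) \<open>M > 1\<close> high _ loc] assms(7)
    by (metis greaterThanLessThan_iff)
  have "AE \<omega> in P. \<exists>m. \<forall>i<n. s \<le> \<xi> (Suc (m + i)) \<omega>"
    using noise_AE_run[OF N \<open>s < \<mu>\<close>] .
  then show ?thesis
    using AE_space
  proof eventually_elim
    case (elim \<omega>)
    show ?case
    proof (rule n[of "\<lambda>k. x k \<omega>" "\<lambda>k. \<alpha> + l * \<xi> (Suc k) \<omega>"])
      show "x 0 \<omega> = x\<^sub>0" using elim assms(13) by blast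
      show "x (Suc k) \<omega> = max (f (x k \<omega>) - (\<alpha> + l * \<xi> (Suc k) \<omega>) * (f (x k \<omega>) - x k \<omega>)) 0" for k
        using elim assms(14) by blast
      show "\<alpha> + l * \<xi> (Suc k) \<omega> \<in> {1 - 1 / M\<^sub>\<epsilon>..\<alpha> + l * \<mu>}" for k
      proof -
        have "\<xi> (Suc k) \<omega> \<in> {-1..\<mu>}"
          using N elim by (auto simp: assumption_N_def)
        then have "l * (-1) \<le> l * \<xi> (Suc k) \<omega>" "l * \<xi> (Suc k) \<omega> \<le> l * \<mu>"
          using \<open>l > 0\<close> by (simp_all only: mult_le_cancel_left_pos atLeastAtMost_iff)
        then show ?thesis using low by auto
      qed
      show "\<exists>m. \<forall>i<n. 1 - 1 / M \<le> \<alpha> + l * \<xi> (Suc (m + i)) \<omega>"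
        using elim(1) \<open>l > 0\<close> by (auto simp: s_def field_simps)
    qed
  qed
qed

end
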